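(* Suppose $G_{1}=(V_{1},E_{1})$ and $G_{2}=(V_{2},E_{2})$ are vertex disjoint finite simple undirected graphs. The connected neighborhood polynomial of their join $G_{1}+G_{2}$ satisfies \begin{align*} N^{(c)}(G_{1}+G_{2},x)=\;&S(G_{1},x)+S(G_{2},x)\\ &+(N(G_{1},x)-1)\bigl((1+x)^{|V_{2}|}-1\bigr)\\ &+(N(G_{2},x)-1)\bigl((1+x)^{|V_{1}|}-1\bigr)\\ &-(N(G_{1},x)-1)(N(G_{2},x)-1). \end{align*}
   Context: For a finite simple undirected graph $G=(V,E)$ and $v\in V$, the open neighborhood of $v$ is $N(v)=\{u \mid \{u,v\}\in E\}$. The neighborhood complex of $G$ is $\mathcal{N}(G)=\{A\subseteq V \mid \exists v\in V: A\subseteq N(v)\}$, and the neighborhood polynomial is $N(G,x)=\sum_{U\in\mathcal{N}(G)}x^{|U|}$. The connected neighborhood polynomial of a graph $G$ of order $n$ is $N^{(c)}(G,x)=\sum_{k=0}^{n} n_k^{(c)}(G)x^k$, where $n_k^{(c)}(G)$ is the number of vertex subsets of cardinality $k$ which are subsets of open neighborhoods of vertices in $G$ and induce a connected subgraph in $G$. The subgraph component polynomial of $G$ is $Q(G;x,y)=\sum_{i=0}^{n}\sum_{j=0}^{n}q_{ij}(G)x^iy^j$, where $q_{ij}(G)$ is the number of sets $X\subseteq V$ with $|X|=i$ such that the induced subgraph $G[X]$ has exactly $j$ connected components. The subgraph polynomial $S(G,x)$ is the coefficient of $y^1$ in $Q(G;x,y)$, written $S(G,x)=\sum_{k=0}^{n}s_k(G)x^k$,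 where $s_k(G)$ is the number of vertex subsets of size $k$ which induce a connected subgraph in $G$. The join $G_1+G_2$ of $G_1=(V_1,E_1)$ and $G_2=(V_2,E_2)$ with disjoint vertex sets is the disjoint union of $G_1$ and $G_2$ (vertex set $V_1\cup V_2$, edge set $E_1\cup E_2$) together with all edges that join vertices in $V_1$ to vertices in $V_2$. *)

theory Defs
  imports
    "HOL-Computational_Algebra.Polynomial"
    "Graph_Theory.Digraph_Component"
begin

text \<open>
  A finite simple undirected graph is a \<^locale>\<open>pair_graph\<close>, i.e. a finite, loop-free, symmetric
  digraph without parallel arcs: the undirected edge \<open>{u, v}\<close> is represented by the two arcs
  \<open>(u, v)\<close> and \<open>(v, u)\<close>. All polynomials have integer coefficients.
\<close>

definition open_nbhd :: "'a pair_pre_digraph \<Rightarrow> 'a \<Rightarrow> 'a set" where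
  "open_nbhd G v = {u. (v, u) \<in> parcs G}"

definition nbhd_complex :: "'a pair_pre_digraph \<Rightarrow> 'a set set" where
  "nbhd_complex G = {A. A \<subseteq> pverts G \<and> (\<exists>v\<in>pverts G. A \<subseteq> open_nbhd G v)}"

definition nbhd_poly :: "'a pair_pre_digraph \<Rightarrow> int poly" where
  "nbhd_poly G = (\<Sum>U\<in>nbhd_complex G. monom 1 (card U))"

text \<open>
  The library predicate \<^const>\<open>connected\<close> is false for the graph without vertices, which has no
  connected component; hence the empty set is counted neither here nor in the subgraph
  polynomial below.
\<close>

definition conn_nbhd_count :: "'a pair_pre_digraph \<Rightarrow> nat \<Rightarrow> nat" where
  "conn_nbhd_count G k =
     card {A \<in> nbhd_complex G. card A = k \<and> connected (with_proj G \<restriction> A)}"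

definition conn_nbhd_poly :: "'a pair_pre_digraph \<Rightarrow> int poly" where
  "conn_nbhd_poly G = (\<Sum>k\<le>card (pverts G). monom (int (conn_nbhd_count G k)) k)"

text \<open>
  In a symmetric digraph the strongly connected components \<^const>\<open>pre_digraph.sccs\<close> are the
  connected components of the undirected graph.
\<close>

definition subgraph_comp_count :: "'a pair_pre_digraph \<Rightarrow> nat \<Rightarrow> nat \<Rightarrow> nat" where
  "subgraph_comp_count G i j =
     card {X. X \<subseteq> pverts G \<and> card X = i \<and> card (pre_digraph.sccs (with_proj G \<restriction> X)) = j}"

text \<open>\<open>Q(G; x, y)\<close> as a polynomial in \<open>y\<close> whose coefficients are polynomials in \<open>x\<close>.\<close>

definition subgraph_comp_poly :: "'a pair_pre_digraph \<Rightarrow> int poly poly" where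
  "subgraph_comp_poly G =
     (\<Sum>i\<le>card (pverts G). \<Sum>j\<le>card (pverts G).
        monom (monom (int (subgraph_comp_count G i j)) i) j)"

definition subgraph_poly :: "'a pair_pre_digraph \<Rightarrow> int poly" where
  "subgraph_poly G = coeff (subgraph_comp_poly G) 1"

text \<open>
  Consequently, the coefficients of the subgraph polynomial count the vertex subsets that induce
  a connected subgraph.
\<close>

lemma (in sym_digraph) connected_iff_card_sccs: "connected G \<longleftrightarrow> card sccs = 1"
proof -
  have sym: "symmetric G" by (rule sym_arcs)
  have *: "connected G \<longleftrightarrow> strongly_connected G"
    using symmetric_connected_imp_strongly_connected[OF sym] reachable_mk_symmetric_eq[OF sym]
    by (auto simp: connected_def strongly_connected_def)
  have "card sccs = 1" if "connected G"
    using that * strongly_connected_eq_iff by simp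
  moreover have "connected G" if c: "card sccs = 1"
  proof -
    obtain S where S: "sccs_verts = {S}"
      using c card_sccs_verts by (metis card_1_singletonE)
    then have ne: "verts G \<noteq> {}" and "\<forall>u\<in>verts G. scc_of u = S"
      unfolding sccs_verts_conv_scc_of by auto
    then have "u \<rightarrow>\<^sup>*\<^bsub>G\<^esub> v" if "u \<in> verts G" "v \<in> verts G" for u v
      using that in_scc_of_self[of v] unfolding scc_of_def by auto
    with ne show ?thesis using * by blast
  qed
  ultimately show ?thesis by blast
qed

lemma coeff_subgraph_poly:
  assumes "pair_graph G"
  shows "coeff (subgraph_poly G) k =
    int (card {X. X \<subseteq> pverts G \<and> card X = k \<and> connected (with_proj G \<restriction> X)})"
proof -
  interpret pair_graph G by fact
  let ?n = "card (pverts G)"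
  let ?C = "{X. X \<subseteq> pverts G \<and> card X = k \<and> connected (with_proj G \<restriction> X)}"
  have conn: "connected (with_proj G \<restriction> X) \<longleftrightarrow> card (pre_digraph.sccs (with_proj G \<restriction> X)) = 1"
    if "X \<subseteq> pverts G" for X
  proof -
    interpret H: sym_digraph "with_proj G \<restriction> X"
      by (rule induced_graph_imp_graph, rule induced_induce) (use that in simp)
    show ?thesis by (rule H.connected_iff_card_sccs)
  qed
  have cnt: "subgraph_comp_count G k 1 = card ?C"
    unfolding subgraph_comp_count_def using conn by (intro arg_cong[where f = card]) auto
  have "?C = {}" if "k > ?n \<or> ?n = 0"
    using that pair_finite_verts card_mono[of "pverts G"]
    by (fastforce simp: connected_conv not_le[symmetric])
  then have zero: "card ?C = 0" if "k > ?n \<or> ?n = 0"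
    using that by simp
  have "coeff (subgraph_poly G) k =
      (\<Sum>i\<le>?n. \<Sum>j\<le>?n. if j = 1 \<and> i = k then int (subgraph_comp_count G i j) else 0)"
    unfolding subgraph_poly_def subgraph_comp_poly_def
    by (simp add: coeff_sum) (intro sum.cong refl, auto)
  also have "\<dots> = (\<Sum>i\<le>?n. if i = k then \<Sum>j\<le>?n. if j = 1 then int (subgraph_comp_count G k j) else 0 else 0)"
    by (intro sum.cong refl) (auto intro!: sum.neutral)
  also have "\<dots> = (if k \<le> ?n \<and> 1 \<le> ?n then int (card ?C) else 0)"
    using cnt by (simp add: sum.delta)
  also have "\<dots> = int (card ?C)" using zero by (auto simp: not_le)
  finally show ?thesis .
qed

definition graph_join :: "'a pair_pre_digraph \<Rightarrow> 'a pair_pre_digraph \<Rightarrow> 'a pair_pre_digraph" where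
  "graph_join G H =
     \<lparr> pverts = pverts G \<union> pverts H,
       parcs = parcs G \<union> parcs H \<union> pverts G \<times> pverts H \<union> pverts H \<times> pverts G \<rparr>"

lemma pair_graph_graph_join:
  assumes "pair_graph G" "pair_graph H" "pverts G \<inter> pverts H = {}"
  shows "pair_graph (graph_join G H)"
proof -
  interpret G: pair_graph G by fact
  interpret H: pair_graph H by fact
  show ?thesis
  proof
    show "symmetric (graph_join G H)"
      using G.arcs_symmetric H.arcs_symmetric
      by (auto simp: symmetric_def graph_join_def intro!: symI)
  next
    fix e assume "e \<in> parcs (graph_join G H)"
    then show "fst e \<noteq> snd e"
      using G.pair_no_loops H.pair_no_loops assms(3) by (auto simp: graph_join_def)
  qed (use G.in_arcsD1 G.in_arcsD2 H.in_arcsD1 H.in_arcsD2 in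
        \<open>auto simp: graph_join_def G.pair_finite_verts H.pair_finite_verts
          G.pair_finite_arcs H.pair_finite_arcs\<close>)
qed

end

theory Submission
  imports Defs
begin

text \<open>
  Every polynomial in the statement is the size generating function
  \<open>\<Sum>A\<in>F. x ^ card A\<close> of a finite family \<open>F\<close> of vertex sets, so the identity reduces to a
  decomposition of one family (lemma \<open>conn_nbhd_sets_join\<close>).

  A vertex \<open>v\<close> of \<open>G\<^sub>1\<close> has the neighbourhood \<open>N\<^bsub>G\<^sub>1\<^esub>(v) \<union> V\<^sub>2\<close> in the join, and symmetrically
  for \<open>G\<^sub>2\<close>. Hence \<open>A \<union> B\<close> with \<open>A \<subseteq> V\<^sub>1\<close> and \<open>B \<subseteq> V\<^sub>2\<close> lies in the neighbourhood complex of
  the join if and only if \<open>A\<close> lies in that of \<open>G\<^sub>1\<close> or \<open>B\<close> lies in that of \<open>G\<^sub>2\<close>. If \<open>B\<close> is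
  empty, this holds because \<open>G\<^sub>2\<close> has a vertex, and what remains is the condition that
  \<open>A\<close> induces a connected subgraph of \<open>G\<^sub>1\<close>; such sets are counted by \<open>S(G\<^sub>1, x)\<close>, and likewise with the roles exchanged. If \<open>A\<close> and \<open>B\<close> are both nonempty, then
  \<open>A \<union> B\<close> is automatically connected, because it induces a graph that contains a complete
  bipartite one. These mixed sets form the union of two families of crosswise unions, namely
  those with \<open>A\<close> in the neighbourhood complex of \<open>G\<^sub>1\<close> and those with \<open>B\<close> in that of \<open>G\<^sub>2\<close>.
  The generating function of a family of crosswise unions of disjoint sets is a product, and
  inclusion-exclusion over the two families yields the three product terms. The summands
  \<open>- 1\<close> remove the empty set from the factors.
\<close>

section \<open>Size generating functions of set families\<close>

definition size_poly :: "'a set set \<Rightarrow> int poly" where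
  "size_poly F = (\<Sum>A\<in>F. monom 1 (card A))"

lemma coeff_size_poly:
  assumes "finite F"
  shows "coeff (size_poly F) k = int (card {A \<in> F. card A = k})"
proof -
  have "coeff (size_poly F) k = (\<Sum>A\<in>F. if card A = k then 1 else 0)"
    by (simp add: size_poly_def coeff_sum)
  also have "\<dots> = int (card {A \<in> F. card A = k})"
    using assms by (simp add: sum.If_cases Int_def)
  finally show ?thesis .
qed

lemma size_poly_Un_disjoint:
  assumes "finite F" "finite H" "F \<inter> H = {}"
  shows "size_poly (F \<union> H) = size_poly F + size_poly H"
  unfolding size_poly_def using assms by (rule sum.union_disjoint)

lemma size_poly_Un:
  assumes "finite F" "finite H"
  shows "size_poly (F \<union> H) = size_poly F + size_poly H - size_poly (F \<inter> H)"
  unfolding size_poly_def using sum.union_inter[OF assms] by (simp add: eq_diff_eq)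

lemma size_poly_remove_empty:
  assumes "finite F" "{} \<in> F"
  shows "size_poly (F - {{}}) = size_poly F - 1"
  unfolding size_poly_def using assms by (simp add: sum_diff1)

definition cross_union :: "'a set set \<Rightarrow> 'a set set \<Rightarrow> 'a set set" where
  "cross_union F H = (\<lambda>(A, B). A \<union> B) ` (F \<times> H)"

lemma finite_cross_union: "finite F \<Longrightarrow> finite H \<Longrightarrow> finite (cross_union F H)"
  unfolding cross_union_def by blast

text \<open>
  Over disjoint ground sets the parts of a union can be recovered by intersecting with the
  ground sets.
\<close>

lemma Un_in_cross_union_iff:
  assumes "F \<subseteq> Pow V" "H \<subseteq> Pow W" "V \<inter> W = {}" "A \<subseteq> V" "B \<subseteq> W"
  shows "A \<union> B \<in> cross_union F H \<longleftrightarrow> A \<in> F \<and> B \<in> H"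
proof
  assume "A \<union> B \<in> cross_union F H"
  then obtain A' B' where *: "A' \<in> F" "B' \<in> H" "A \<union> B = A' \<union> B'"
    unfolding cross_union_def by auto
  then have "A' \<subseteq> V" "B' \<subseteq> W" using assms by auto
  then have "A = A'" "B = B'" using *(3) assms(3-5) by blast+
  then show "A \<in> F \<and> B \<in> H" using * by simp
qed (auto simp: cross_union_def)

lemma cross_union_Int:
  assumes "F \<subseteq> Pow V" "F' \<subseteq> Pow V" "H \<subseteq> Pow W" "H' \<subseteq> Pow W" "V \<inter> W = {}"
  shows "cross_union F H \<inter> cross_union F' H' = cross_union (F \<inter> F') (H \<inter> H')"
proof
  show "cross_union F H \<inter> cross_union F' H' \<subseteq> cross_union (F \<inter> F') (H \<inter> H')"
  proof
    fix X assume X: "X \<in> cross_union F H \<inter> cross_union F' H'"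
    then obtain A B where AB: "A \<in> F" "B \<in> H" "X = A \<union> B"
      unfolding cross_union_def by auto
    then have "A \<in> F' \<and> B \<in> H'"
      using X Un_in_cross_union_iff[of F' V H' W A B] assms by blast
    then show "X \<in> cross_union (F \<inter> F') (H \<inter> H')"
      using AB unfolding cross_union_def by auto
  qed
qed (auto simp: cross_union_def)

lemma size_poly_cross_union:
  assumes "F \<subseteq> Pow V" "H \<subseteq> Pow W" "finite V" "finite W" "V \<inter> W = {}"
  shows "size_poly (cross_union F H) = size_poly F * size_poly H"
proof -
  have inj: "inj_on (\<lambda>(A, B). A \<union> B) (F \<times> H)"
  proof (rule inj_onI, clarify)
    fix A B A' B' assume *: "A \<in> F" "B \<in> H" "A' \<in> F" "B' \<in> H" "A \<union> B = A' \<union> B'"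
    then have "A \<subseteq> V" "A' \<subseteq> V" "B \<subseteq> W" "B' \<subseteq> W" using assms by auto
    then show "A = A' \<and> B = B'" using *(5) assms(5) by blast
  qed
  have card: "card (A \<union> B) = card A + card B" if "A \<in> F" "B \<in> H" for A B
  proof -
    have "A \<subseteq> V" "B \<subseteq> W" using that assms(1,2) by auto
    then show ?thesis
      using assms(3-5) by (intro card_Un_disjoint) (auto intro: finite_subset)
  qed
  have "size_poly (cross_union F H) = (\<Sum>(A, B)\<in>F \<times> H. monom 1 (card (A \<union> B)))"
    unfolding size_poly_def cross_union_def sum.reindex[OF inj]
    by (simp add: o_def case_prod_unfold)
  also have "\<dots> = (\<Sum>(A, B)\<in>F \<times> H. monom 1 (card A) * monom 1 (card B))"
    by (intro sum.cong refl) (auto simp: card mult_monom)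
  also have "\<dots> = size_poly F * size_poly H"
    unfolding size_poly_def by (simp add: sum_product sum.cartesian_product)
  finally show ?thesis .
qed

lemma size_poly_Pow:
  assumes "finite V"
  shows "size_poly (Pow V) = (1 + monom 1 1) ^ card V"
  using assms
proof (induction V)
  case empty
  show ?case by (simp add: size_poly_def)
next
  case (insert a V)
  have "Pow (insert a V) = cross_union {{}, {a}} (Pow V)"
    unfolding cross_union_def Pow_insert by auto
  moreover have "size_poly {{}, {a}} = 1 + monom 1 1"
    by (simp add: size_poly_def)
  ultimately show ?case
    using insert size_poly_cross_union[of "{{}, {a}}" "{a}" "Pow V" V] by simp
qed

section \<open>The graph polynomials as size generating functions\<close>

abbreviation conn_sets :: "'a pair_pre_digraph \<Rightarrow> 'a set set" where
  "conn_sets G \<equiv> {X. X \<subseteq> pverts G \<and> connected (with_proj G \<restriction> X)}"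

lemma nbhd_complex_subset: "nbhd_complex G \<subseteq> Pow (pverts G)"
  unfolding nbhd_complex_def by auto

lemma empty_in_nbhd_complex: "pverts G \<noteq> {} \<Longrightarrow> {} \<in> nbhd_complex G"
  unfolding nbhd_complex_def by auto

lemma nbhd_poly_minus_1:
  assumes "finite (pverts G)" "pverts G \<noteq> {}"
  shows "nbhd_poly G - 1 = size_poly (nbhd_complex G - {{}})"
proof -
  have "finite (nbhd_complex G)"
    using assms(1) by (intro finite_subset[OF nbhd_complex_subset]) simp
  moreover have "nbhd_poly G = size_poly (nbhd_complex G)"
    by (simp add: nbhd_poly_def size_poly_def)
  ultimately show ?thesis
    using empty_in_nbhd_complex[OF assms(2)] by (simp add: size_poly_remove_empty)
qed

lemma subgraph_poly_eq_size_poly: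
  assumes "pair_graph G"
  shows "subgraph_poly G = size_poly (conn_sets G)"
proof -
  interpret pair_graph G by fact
  have "finite (conn_sets G)" by simp
  then show ?thesis
    by (intro poly_eqI)
      (auto simp: coeff_subgraph_poly[OF assms] coeff_size_poly intro!: arg_cong[where f = card])
qed

lemma conn_nbhd_poly_eq_size_poly:
  assumes "finite (pverts G)"
  shows "conn_nbhd_poly G = size_poly (nbhd_complex G \<inter> conn_sets G)"
proof (rule poly_eqI)
  fix k
  let ?F = "nbhd_complex G \<inter> conn_sets G"
  have "finite ?F" using assms by simp
  then have F: "coeff (size_poly ?F) k = int (conn_nbhd_count G k)"
    using nbhd_complex_subset[of G]
    by (auto simp: coeff_size_poly conn_nbhd_count_def intro!: arg_cong[where f = card])
  have "conn_nbhd_count G k = 0" if "k > card (pverts G)"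
  proof -
    have "{A \<in> nbhd_complex G. card A = k \<and> connected (with_proj G \<restriction> A)} = {}"
    proof -
      have "card A \<noteq> k" if "A \<in> nbhd_complex G" for A
        using card_mono[OF assms, of A] nbhd_complex_subset[of G] that \<open>k > card (pverts G)\<close>
        by auto
      then show ?thesis by blast
    qed
    then show ?thesis unfolding conn_nbhd_count_def by (metis card.empty)
  qed
  then show "coeff (conn_nbhd_poly G) k = coeff (size_poly ?F) k"
    unfolding F by (auto simp: conn_nbhd_poly_def coeff_sum not_le[symmetric])
qed

section \<open>Neighbourhoods and connectedness in a join\<close>

lemma graph_join_commute: "graph_join G H = graph_join H G"
  unfolding graph_join_def by auto

lemma open_nbhd_graph_join:
  assumes "pair_graph G" "pair_graph H" "pverts G \<inter> pverts H = {}" "v \<in> pverts G"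
  shows "open_nbhd (graph_join G H) v = open_nbhd G v \<union> pverts H"
proof -
  interpret G: pair_graph G by fact
  interpret H: pair_graph H by fact
  show ?thesis
    using assms(3,4) H.in_arcsD1 unfolding open_nbhd_def graph_join_def by auto
qed

text \<open>
  The neighbourhood of a vertex on one side contains the whole other side, so it only restricts
  the part on its own side.
\<close>

lemma Un_in_nbhd_complex_graph_join_iff:
  assumes "pair_graph G" "pair_graph H" "pverts G \<inter> pverts H = {}"
    and "A \<subseteq> pverts G" "B \<subseteq> pverts H"
  shows "A \<union> B \<in> nbhd_complex (graph_join G H) \<longleftrightarrow> A \<in> nbhd_complex G \<or> B \<in> nbhd_complex H"
proof -
  interpret G: pair_graph G by fact
  interpret H: pair_graph H by fact
  have left: "A \<union> B \<subseteq> open_nbhd (graph_join G H) v \<longleftrightarrow> A \<subseteq> open_nbhd G v"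
    if "v \<in> pverts G" for v
    using open_nbhd_graph_join[OF assms(1-3) that] assms(3-5) by auto
  have disj: "pverts H \<inter> pverts G = {}" using assms(3) by auto
  have right: "A \<union> B \<subseteq> open_nbhd (graph_join G H) v \<longleftrightarrow> B \<subseteq> open_nbhd H v"
    if "v \<in> pverts H" for v
    using open_nbhd_graph_join[OF assms(2,1) disj that] assms(3-5)
    unfolding graph_join_commute[of G H] by auto
  have "pverts (graph_join G H) = pverts G \<union> pverts H" by (simp add: graph_join_def)
  then have "A \<union> B \<in> nbhd_complex (graph_join G H) \<longleftrightarrow>
      (\<exists>v\<in>pverts G. A \<subseteq> open_nbhd G v) \<or> (\<exists>v\<in>pverts H. B \<subseteq> open_nbhd H v)"
    using assms(4,5) left right by (auto simp: nbhd_complex_def bex_Un simp del: Un_subset_iff)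
  then show ?thesis
    using assms(4,5) by (simp add: nbhd_complex_def)
qed

lemma induce_graph_join_left:
  assumes "pair_graph H" "pverts G \<inter> pverts H = {}" "A \<subseteq> pverts G"
  shows "with_proj (graph_join G H) \<restriction> A = with_proj G \<restriction> A"
proof -
  interpret H: pair_graph H by fact
  show ?thesis
    using assms(2,3) H.in_arcsD1 unfolding induce_subgraph_def graph_join_def by auto
qed

text \<open>
  Two vertices on different sides are adjacent, and two vertices on the same side have every
  vertex of the other side as a common neighbour.
\<close>

lemma connected_graph_join_mixed:
  assumes "A \<subseteq> pverts G" "B \<subseteq> pverts H" "A \<noteq> {}" "B \<noteq> {}"
  shows "connected (with_proj (graph_join G H) \<restriction> (A \<union> B))"
proof -
  let ?K = "with_proj (graph_join G H) \<restriction> (A \<union> B)"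
  let ?R = "rtrancl_on (A \<union> B) ((arcs_ends ?K)\<^sup>s)"
  have edge: "(u, v) \<in> arcs_ends ?K" "(v, u) \<in> arcs_ends ?K" if "u \<in> A" "v \<in> B" for u v
    using that assms(1,2) by (auto simp: arcs_ends_def arc_to_ends_def graph_join_def)
  have step: "(w, v) \<in> ?R"
    if "(w, u) \<in> ?R" "u \<in> A \<and> v \<in> B \<or> u \<in> B \<and> v \<in> A" for u v w
  proof (rule rtrancl_on_into_rtrancl_on[OF that(1)])
    show "(u, v) \<in> (arcs_ends ?K)\<^sup>s" using that(2) edge unfolding symcl_def by blast
    show "v \<in> A \<union> B" using that(2) by blast
  qed
  obtain a b where ab: "a \<in> A" "b \<in> B" using assms(3,4) by blast
  have "(u, v) \<in> ?R" if uv: "u \<in> A \<union> B" "v \<in> A \<union> B" for u v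
  proof -
    have refl: "(u, u) \<in> ?R" using uv(1) by (rule rtrancl_on_refl)
    consider "u \<in> A" "v \<in> A" | "u \<in> B" "v \<in> B" | "u \<in> A \<and> v \<in> B \<or> u \<in> B \<and> v \<in> A"
      using uv by blast
    then show ?thesis
    proof cases
      case 1
      then show ?thesis using step[OF step[OF refl, of b], of v] ab by blast
    next
      case 2
      then show ?thesis using step[OF step[OF refl, of a], of v] ab by blast
    next
      case 3
      then show ?thesis by (rule step[OF refl])
    qed
  qed
  then show ?thesis using ab unfolding connected_conv by auto
qed

text \<open>
  On the right-hand side the mixed sets are listed with possible overlap, so that each of the
  two families is a full product; the overlap is accounted for when they are counted.
\<close>

lemma conn_nbhd_sets_join:
  assumes "pair_graph G" "pair_graph H" "pverts G \<noteq> {}" "pverts H \<noteq> {}"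
    and "pverts G \<inter> pverts H = {}"
  shows "nbhd_complex (graph_join G H) \<inter> conn_sets (graph_join G H) =
    conn_sets G \<union> conn_sets H \<union>
    (cross_union (nbhd_complex G - {{}}) (Pow (pverts H) - {{}}) \<union>
     cross_union (Pow (pverts G) - {{}}) (nbhd_complex H - {{}}))"
    (is "?L = _ \<union> _ \<union> (?M \<union> ?N)")
proof (rule set_eqI)
  fix X
  have verts: "pverts (graph_join G H) = pverts G \<union> pverts H" by (simp add: graph_join_def)
  show "X \<in> ?L \<longleftrightarrow> X \<in> conn_sets G \<union> conn_sets H \<union> (?M \<union> ?N)"
  proof (cases "X \<subseteq> pverts G \<union> pverts H")
    case False
    then show ?thesis
      using nbhd_complex_subset[of G] nbhd_complex_subset[of H]
      by (auto simp: verts cross_union_def)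
  next
    case True
    define A B where "A = X \<inter> pverts G" and "B = X \<inter> pverts H"
    have X: "X = A \<union> B" and A: "A \<subseteq> pverts G" and B: "B \<subseteq> pverts H"
      using True unfolding A_def B_def by auto
    have nbhd: "X \<in> nbhd_complex (graph_join G H) \<longleftrightarrow> A \<in> nbhd_complex G \<or> B \<in> nbhd_complex H"
      unfolding X using assms A B by (intro Un_in_nbhd_complex_graph_join_iff)
    have M: "X \<in> ?M \<longleftrightarrow> A \<in> nbhd_complex G - {{}} \<and> B \<noteq> {}"
      unfolding X using Un_in_cross_union_iff[OF _ _ assms(5) A B, of "nbhd_complex G - {{}}"
          "Pow (pverts H) - {{}}"] nbhd_complex_subset[of G] B by blast
    have N: "X \<in> ?N \<longleftrightarrow> A \<noteq> {} \<and> B \<in> nbhd_complex H - {{}}"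
      unfolding X using Un_in_cross_union_iff[OF _ _ assms(5) A B, of "Pow (pverts G) - {{}}"
          "nbhd_complex H - {{}}"] nbhd_complex_subset[of H] A by blast
    have ne: "{} \<in> nbhd_complex G" "{} \<in> nbhd_complex H"
      using assms(3,4) by (auto intro: empty_in_nbhd_complex)
    have not_conn_empty: "\<not> connected (with_proj K \<restriction> {})" for K :: "'a pair_pre_digraph"
      by (simp add: connected_conv)
    consider "A = {}" | "B = {}" | "A \<noteq> {}" "B \<noteq> {}" by blast
    then show ?thesis
    proof cases
      case 1
      have "with_proj (graph_join G H) \<restriction> B = with_proj H \<restriction> B"
        using assms(5) induce_graph_join_left[OF assms(1) _ B]
        unfolding graph_join_commute[of G H] by (simp add: Int_commute)
      moreover have "X \<in> conn_sets G \<Longrightarrow> X = {}"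
        using 1 by (auto simp: A_def)
      ultimately show ?thesis
        using 1 nbhd M N B ne not_conn_empty by (auto simp: X verts)
    next
      case 2
      have "with_proj (graph_join G H) \<restriction> A = with_proj G \<restriction> A"
        using induce_graph_join_left[OF assms(2,5) A] .
      moreover have "X \<in> conn_sets H \<Longrightarrow> X = {}"
        using 2 by (auto simp: B_def)
      ultimately show ?thesis
        using 2 nbhd M N A ne not_conn_empty by (auto simp: X verts)
    next
      case 3
      then have "\<not> X \<subseteq> pverts G" "\<not> X \<subseteq> pverts H"
        using assms(5) unfolding A_def B_def by auto
      moreover have "connected (with_proj (graph_join G H) \<restriction> X)"
        unfolding X using A B 3 by (rule connected_graph_join_mixed)
      ultimately show ?thesis
        using 3 nbhd M N True verts by auto
    qed
  qed
qed

section \<open>The connected neighbourhood polynomial of a join\<close>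

theorem theorem6:
  fixes G1 G2 :: "'a pair_pre_digraph"
  assumes "pair_graph G1" and "pair_graph G2"
    and "pverts G1 \<noteq> {}" and "pverts G2 \<noteq> {}"
    and "pverts G1 \<inter> pverts G2 = {}"
  shows "conn_nbhd_poly (graph_join G1 G2) =
           subgraph_poly G1 + subgraph_poly G2
         + (nbhd_poly G1 - 1) * ((1 + monom 1 1) ^ card (pverts G2) - 1)
         + (nbhd_poly G2 - 1) * ((1 + monom 1 1) ^ card (pverts G1) - 1)
         - (nbhd_poly G1 - 1) * (nbhd_poly G2 - 1)"
proof -
  interpret G1: pair_graph G1 by fact
  interpret G2: pair_graph G2 by fact
  note fin = G1.pair_finite_verts G2.pair_finite_verts
  define N1 N2 where "N1 = nbhd_complex G1 - {{}}" and "N2 = nbhd_complex G2 - {{}}"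
  define P1 P2 where "P1 = Pow (pverts G1) - {{}}" and "P2 = Pow (pverts G2) - {{}}"
  have sub: "N1 \<subseteq> P1" "N2 \<subseteq> P2" "P1 \<subseteq> Pow (pverts G1)" "P2 \<subseteq> Pow (pverts G2)"
    using nbhd_complex_subset unfolding N1_def N2_def P1_def P2_def by auto
  have sub': "N1 \<subseteq> Pow (pverts G1)" "N2 \<subseteq> Pow (pverts G2)"
    using sub by auto
  have finP: "finite P1" "finite P2"
    using fin unfolding P1_def P2_def by auto
  then have finN: "finite N1" "finite N2"
    using sub finite_subset by blast+
  let ?M = "cross_union N1 P2 \<union> cross_union P1 N2"
  have finM: "finite (cross_union N1 P2)" "finite (cross_union P1 N2)"
    using finN finP by (auto intro: finite_cross_union)
  have N: "size_poly N1 = nbhd_poly G1 - 1" "size_poly N2 = nbhd_poly G2 - 1"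
    using fin assms(3,4) unfolding N1_def N2_def by (simp_all add: nbhd_poly_minus_1)
  have P: "size_poly P1 = (1 + monom 1 1) ^ card (pverts G1) - 1"
    "size_poly P2 = (1 + monom 1 1) ^ card (pverts G2) - 1"
    using fin unfolding P1_def P2_def by (simp_all add: size_poly_remove_empty size_poly_Pow)
  have "cross_union N1 P2 \<inter> cross_union P1 N2 = cross_union (N1 \<inter> P1) (P2 \<inter> N2)"
    using sub' sub(3,4) assms(5) by (intro cross_union_Int)
  also have "\<dots> = cross_union N1 N2"
    using sub(1,2) by (simp add: Int_absorb1 Int_absorb2)
  finally have M: "size_poly ?M =
      size_poly N1 * size_poly P2 + size_poly P1 * size_poly N2 - size_poly N1 * size_poly N2"
    using size_poly_Un[OF finM] size_poly_cross_union[OF _ _ fin assms(5)] sub' sub(3,4) by simp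
  have conn_disj: "conn_sets G1 \<inter> conn_sets G2 = {}"
  proof (rule equals0I)
    fix X assume "X \<in> conn_sets G1 \<inter> conn_sets G2"
    then have "X \<subseteq> pverts G1 \<inter> pverts G2" "connected (with_proj G1 \<restriction> X)" by auto
    then show False using assms(5) by (simp add: connected_conv)
  qed
  have mixed_disj: "(conn_sets G1 \<union> conn_sets G2) \<inter> ?M = {}"
  proof (rule equals0I)
    fix X assume X: "X \<in> (conn_sets G1 \<union> conn_sets G2) \<inter> ?M"
    then obtain A B where "A \<in> P1" "B \<in> P2" "X = A \<union> B"
      using sub(1,2) unfolding cross_union_def by auto
    then have "A \<noteq> {}" "A \<subseteq> pverts G1" "A \<subseteq> X" "B \<noteq> {}" "B \<subseteq> pverts G2" "B \<subseteq> X"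
      unfolding P1_def P2_def by auto
    moreover have "X \<subseteq> pverts G1 \<or> X \<subseteq> pverts G2" using X by auto
    ultimately show False using assms(5) by blast
  qed
  have finC: "finite (conn_sets G1)" "finite (conn_sets G2)"
    using fin by simp_all
  have "finite (pverts (graph_join G1 G2))"
    using fin by (simp add: graph_join_def)
  then have "conn_nbhd_poly (graph_join G1 G2) = size_poly (conn_sets G1 \<union> conn_sets G2 \<union> ?M)"
    unfolding N1_def N2_def P1_def P2_def conn_nbhd_sets_join[OF assms, symmetric]
    by (rule conn_nbhd_poly_eq_size_poly)
  also have "\<dots> = size_poly (conn_sets G1) + size_poly (conn_sets G2) + size_poly ?M"
    using size_poly_Un_disjoint[OF _ _ mixed_disj] size_poly_Un_disjoint[OF finC conn_disj]
      finC finM by simp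
  also have "\<dots> = subgraph_poly G1 + subgraph_poly G2 +
      (size_poly N1 * size_poly P2 + size_poly P1 * size_poly N2 - size_poly N1 * size_poly N2)"
    unfolding M subgraph_poly_eq_size_poly[OF assms(1)] subgraph_poly_eq_size_poly[OF assms(2)] ..
  finally show ?thesis
    unfolding N P by (simp only: mult.commute add.assoc add_diff_eq)
qed

end
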